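(* Suppose that $q\equiv\pm1\pmod{16}$, so that $2$ is a square in $\mathbb{F}_q$, and set $c=(2+\sqrt2)/4\in\mathbb{F}_q$ for either choice of the square root $\sqrt2\in\mathbb{F}_q$. Then $c\in\mathcal{C}$, and for $s\in\mathbb{F}_q$ with $1-s^2=c$, each monic irreducible factor $I(y)$ of $g_s(y)$ over $\mathbb{F}_q$ has the form $$y^8-4y^7+\frac{13}{2}y^6-\frac{11}{2}y^5+\frac{165}{64}y^4-\frac{21}{32}y^3+\frac{21}{256}y^2-\frac{1}{256}y-m$$ for some $m\in\mathbb{F}_q$.
   Context: $\mathbb{F}_q$ is a finite field with $q$ elements, $q$ a power of an odd prime; $n=(q+1)/2$; for $s\in\mathbb{F}_q$, $g_s(y) := y^n+(1-y)^n-s \in \mathbb{F}_q[y]$. $\rho$ is the quadratic character on $\mathbb{F}_q$ and $\mathcal{C} := \{a \in \mathbb{F}_q : \rho(a)=\rho(1-a)=1\}$. *)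

theory Defs
  imports "HOL-Computational_Algebra.Computational_Algebra" "HOL-Number_Theory.Cong"
    "HOL-Library.Cardinality"
begin

definition quad_char :: "'a :: finite_field \<Rightarrow> int" where
  "quad_char a = (if a = 0 then 0 else if is_square a then 1 else -1)"

definition C_set :: "'a :: finite_field set" where
  "C_set = {a. quad_char a = 1 \<and> quad_char (1 - a) = 1}"

text \<open>
  The field is the whole type, so its order \<open>q\<close> is \<open>CARD('a)\<close>; the
  exponent is \<open>n = (q + 1) / 2\<close>, exact for odd \<open>q\<close>.
\<close>

definition g_poly :: "'a :: finite_field \<Rightarrow> 'a poly" where
  "g_poly s =
     (let n = (CARD('a) + 1) div 2; y = [:0, 1:] in y ^ n + (1 - y) ^ n - [:s:])"

end

theory Submission
  imports "HOL-Algebra.Algebraic_Closure_Type" "HOL-Number_Theory.Residues" Defs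
begin

text \<open>
  The proof is trigonometry in the algebraic closure of the field. A root \<open>y\<close> of
  \<open>g_poly s\<close> is written as \<open>y = sin\<^sup>2 \<psi>\<close>, that is, \<open>y = a\<^sup>2\<close> and \<open>1 - y = b\<^sup>2\<close> with \<open>a = sin \<psi>\<close>
  and \<open>b = cos \<psi>\<close>. Let \<open>q\<close> be the order of the field and \<open>A = a\<^sup>q\<close>, \<open>B = b\<^sup>q\<close> the Frobenius images.
  As \<open>2 * n = q + 1\<close>, the equation \<open>y\<^sup>n + (1 - y)\<^sup>n = s\<close> reads \<open>a * A + b * B = s\<close>: it is the
  addition theorem, and it says that the angle of \<open>(A, B)\<close> differs from \<open>\<psi>\<close> by an angle
  \<open>\<theta>\<close> with \<open>cos \<theta> = s\<close>. The condition \<open>1 - s\<^sup>2 = (2 + r) / 4\<close> forces \<open>\<theta>\<close> to be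
  an odd multiple of \<open>\<pi> / 8\<close>. In terms of \<open>x = exp (2 * \<i> * \<psi>)\<close>, Frobenius therefore moves
  \<open>y\<close> by turning \<open>x\<close> through a primitive 8th root of unity (\<open>conjugates_of_root_of_g_poly\<close>).

  This has two consequences. The conjugates of \<open>y\<close> include the values belonging to the eight
  rotated points, and these are distinct, because otherwise \<open>x\<close> would be a 16th root of unity and
  Frobenius, which fixes or inverts such roots, would not rotate it; so \<open>y\<close> has degree at least 8.
  On the other hand \<open>x ^ 8 + 1 / x ^ 8\<close> is invariant under the rotation, and by the
  Chebyshev polynomial of degree 8 it is a polynomial of degree 8 in \<open>y\<close>
  (\<open>poly_octic_sin_half_sq\<close>). Hence this polynomial takes a value \<open>m\<close> of the ground field
  at \<open>y\<close>, and after subtracting \<open>m\<close> it must be the minimal polynomial of \<open>y\<close>.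

  The membership of \<open>c\<close> in \<open>C_set\<close> comes from the same roots of unity: for a primitive
  16th root of unity \<open>z\<close>, the sum \<open>z + 1 / z\<close> lies in the ground field, and its square
  is \<open>2 + r\<close> for a square root \<open>r\<close> of 2 (\<open>is_square_two_plus_minus_sqrt_two\<close>).
\<close>

section \<open>The Frobenius map on the algebraic closure of a finite field\<close>

text \<open>
  Let \<open>q\<close> be the order of the field. As \<open>z\<^sup>q = z\<close> on the field, the inner terms of the expansion of
  \<open>(x + 1)\<^sup>q\<close> form a polynomial of degree below \<open>q\<close> that vanishes at all \<open>q\<close> elements, so its
  coefficients are zero. This is what makes the \<open>q\<close>-th power additive on the closure.
\<close>
lemma of_nat_CARD_choose_eq_0:
  assumes "0 < k" "k < CARD('a :: finite_field)"
  shows "of_nat (CARD('a) choose k) = (0 :: 'a)"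
proof -
  define q where "q = CARD('a)"
  define p :: "'a poly" where "p = (\<Sum>j\<in>{1..<q}. monom (of_nat (q choose j)) j)"
  have q1: "q > 1" using assms by (simp add: q_def)
  have root: "poly p x = 0" for x
  proof -
    have "{..q} = insert 0 (insert q {1..<q})" using q1 by auto
    hence "(x + 1) ^ q = 1 + x ^ q + poly p x"
      using q1 by (simp add: binomial_ring p_def poly_sum poly_monom mult.commute)
    moreover have "z ^ q = z" for z :: 'a
      by (simp add: q_def finite_field_power_card_eq_same)
    ultimately show ?thesis by (simp add: algebra_simps)
  qed
  have "p = 0"
  proof (rule ccontr)
    assume "p \<noteq> 0"
    hence "card {x. poly p x = 0} \<le> degree p" by (rule card_poly_roots_bound)
    hence "q \<le> degree p" by (simp add: root q_def)
    moreover have "degree p \<le> q - 1"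
      unfolding p_def by (intro degree_sum_le) (auto intro: order.trans[OF degree_monom_le])
    ultimately show False using q1 by simp
  qed
  hence "coeff p k = 0" by simp
  thus ?thesis using assms by (simp add: p_def coeff_sum q_def sum.delta')
qed

definition frob :: "'a :: finite_field alg_closure \<Rightarrow> 'a alg_closure" where
  "frob x = x ^ CARD('a)"

lemma frob_0 [simp]: "frob 0 = 0"
  and frob_1 [simp]: "frob 1 = 1"
  and frob_mult: "frob (x * y) = frob x * frob y"
  and frob_power: "frob (x ^ n) = frob x ^ n"
  and frob_inverse: "frob (inverse x) = inverse (frob x)"
  and frob_divide: "frob (x / y) = frob x / frob y"
  by (simp_all add: frob_def power_mult_distrib power_inverse power_divide flip: power_mult)
     (simp add: mult.commute)

lemma frob_to_ac [simp]: "frob (to_ac a) = to_ac a"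
  by (simp add: frob_def finite_field_power_card_eq_same flip: to_ac_power)

lemma frob_numeral [simp]: "frob (numeral n :: 'a :: finite_field alg_closure) = numeral n"
  using frob_to_ac[of "numeral n :: 'a"] by simp

lemma frob_add: "frob (x + y) = frob x + frob (y :: 'a :: finite_field alg_closure)"
proof -
  define q where "q = CARD('a)"
  have q1: "q > 0" by (simp add: q_def)
  have "of_nat (q choose k) * x ^ k * y ^ (q - k) = 0" if "k \<in> {..q} - {0, q}" for k
  proof -
    have "to_ac (of_nat (q choose k) :: 'a) = 0"
      using of_nat_CARD_choose_eq_0[of k, where 'a = 'a] that by (simp add: q_def del: to_ac_of_nat)
    thus ?thesis by simp
  qed
  hence "(\<Sum>k\<le>q. of_nat (q choose k) * x ^ k * y ^ (q - k)) =
         (\<Sum>k\<in>{0, q}. of_nat (q choose k) * x ^ k * y ^ (q - k))"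
    by (intro sum.mono_neutral_right) auto
  thus ?thesis
    using q1 by (simp add: frob_def binomial_ring add.commute flip: q_def)
qed

lemma frob_minus: "frob (- x) = - frob x"
  using frob_add[of x "- x"] by (simp add: eq_neg_iff_add_eq_0 add.commute)

lemma frob_diff: "frob (x - y) = frob x - frob y"
  using frob_add[of x "- y"] by (simp add: frob_minus)

text \<open>
  The fixed points are the roots of \<open>X\<^sup>q - X\<close>; there are at most \<open>q\<close> of them, and the ground field
  already supplies \<open>q\<close>.
\<close>
lemma frob_fixed_imp_range:
  fixes x :: "'a :: finite_field alg_closure"
  assumes "frob x = x"
  shows "x \<in> range to_ac"
proof -
  define q where "q = CARD('a)"
  define p :: "'a alg_closure poly" where "p = monom 1 q - monom 1 1"
  have q1: "q > 1"
    using card_mono[of UNIV "{0, 1 :: 'a}"] by (simp add: q_def)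
  have "degree p = q"
    using degree_add_eq_left[of "- monom 1 1" "monom (1 :: 'a alg_closure) q"] q1
    by (simp add: p_def degree_monom_eq)
  hence "p \<noteq> 0" using q1 by auto
  have roots: "{x. poly p x = 0} = {x. frob x = x}"
    by (simp add: p_def poly_monom frob_def q_def)
  have "range to_ac = {x. frob (x :: 'a alg_closure) = x}"
  proof (rule card_seteq)
    show "finite {x. frob (x :: 'a alg_closure) = x}"
      using poly_roots_finite[OF \<open>p \<noteq> 0\<close>] by (simp add: roots)
    show "card {x. frob (x :: 'a alg_closure) = x} \<le> card (range (to_ac :: 'a \<Rightarrow> _))"
      using card_poly_roots_bound[OF \<open>p \<noteq> 0\<close>]
      by (simp add: roots \<open>degree p = q\<close> card_image inj_to_ac q_def)
  qed auto
  thus ?thesis using assms by auto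
qed

section \<open>Polynomials over the ground field and their roots in the closure\<close>

lemma map_poly_to_ac_mult: "map_poly to_ac (p * q) = map_poly to_ac p * map_poly to_ac q"
  by (rule poly_eqI) (simp add: coeff_map_poly coeff_mult to_ac_sum)

lemma map_poly_to_ac_add: "map_poly to_ac (p + q) = map_poly to_ac p + map_poly to_ac q"
  by (rule poly_eqI) (simp add: coeff_map_poly)

lemma map_poly_to_ac_diff: "map_poly to_ac (p - q) = map_poly to_ac p - map_poly to_ac q"
  by (rule poly_eqI) (simp add: coeff_map_poly)

lemma map_poly_to_ac_power: "map_poly to_ac (p ^ n) = map_poly to_ac p ^ n"
  by (induction n) (simp_all add: map_poly_to_ac_mult)

lemmas map_poly_to_ac_simps = map_poly_to_ac_mult map_poly_to_ac_add map_poly_to_ac_diff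
  map_poly_to_ac_power map_poly_pCons map_poly_monom

lemma degree_map_poly_to_ac [simp]: "degree (map_poly to_ac p) = degree p"
  by (rule degree_map_poly) simp

lemma map_poly_to_ac_eq_0_iff [simp]: "map_poly to_ac p = 0 \<longleftrightarrow> p = 0"
  by (rule map_poly_eq_0_iff) simp_all

lemma frob_poly: "frob (poly (map_poly to_ac p) y) = poly (map_poly to_ac p) (frob y)"
  by (induction p) (simp_all add: map_poly_pCons frob_add frob_mult)

text \<open>
  The polynomials vanishing at \<open>y\<close> are the multiples of one of least degree \<open>d\<close>. An
  irreducible polynomial among them is associated to \<open>d\<close>.
\<close>
lemma irreducible_dvd_if_common_root:
  fixes I Q :: "'a :: field poly"
  assumes I: "irreducible I" "poly (map_poly to_ac I) y = 0"
    and Q: "poly (map_poly to_ac Q) y = 0"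
  shows "I dvd Q"
proof -
  define V where "V = (\<lambda>p :: 'a poly. p \<noteq> 0 \<and> poly (map_poly to_ac p) y = 0)"
  have "V I" using I by (auto simp: V_def)
  then obtain d where d: "V d" and min: "\<And>p. V p \<Longrightarrow> degree d \<le> degree p"
    using ex_has_least_nat[of V I degree] by blast
  have dvd: "d dvd p" if "poly (map_poly to_ac p) y = 0" for p
  proof (rule ccontr)
    assume "\<not> d dvd p"
    hence nz: "p mod d \<noteq> 0" by (simp add: dvd_eq_mod_eq_0)
    have "poly (map_poly to_ac p) y =
            poly (map_poly to_ac (p div d * d + p mod d)) y" by simp
    also have "\<dots> = poly (map_poly to_ac (p mod d)) y"
      unfolding map_poly_to_ac_simps using d by (simp add: V_def)
    finally have "V (p mod d)" using nz that by (simp add: V_def)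
    hence "degree d \<le> degree (p mod d)" by (rule min)
    moreover have "degree (p mod d) < degree d"
      using nz d degree_mod_less[of d p] by (auto simp: V_def)
    ultimately show False by simp
  qed
  have "\<not> is_unit d"
  proof
    assume "is_unit d"
    then obtain a where "d = [:a:]" "a \<noteq> 0"
      using d by (auto simp: V_def is_unit_iff_degree elim: degree_eq_zeroE)
    thus False using d by (simp add: V_def map_poly_pCons)
  qed
  moreover obtain u where u: "I = d * u" using dvd[OF I(2)] by (elim dvdE)
  ultimately have "is_unit u" using I(1) by (auto dest: irreducibleD)
  hence "I dvd d" by (simp add: u)
  with dvd[OF Q] show ?thesis by (rule dvd_trans[rotated])
qed

section \<open>The squared sine of half the angle\<close>

text \<open>
  Over the complex numbers, \<open>x = exp (\<i> * \<phi>)\<close> gives \<open>(2 - 2 * cos \<phi>) / 4 = sin\<^sup>2 (\<phi> / 2)\<close>.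
\<close>
definition sin_half_sq :: "'a :: field \<Rightarrow> 'a" where
  "sin_half_sq x = (2 - x - inverse x) / 4"

lemma sin_half_sq_inverse [simp]: "sin_half_sq (inverse x) = sin_half_sq x"
  by (simp add: sin_half_sq_def algebra_simps)

lemma four_neq_0: "(2 :: 'a :: field) \<noteq> 0 \<Longrightarrow> (4 :: 'a) \<noteq> 0"
  by (metis mult_eq_0_iff mult_2 numeral_Bit0 numeral_Bit0_eq_double)

lemma four_times_sin_half_sq:
  "(2 :: 'a :: field) \<noteq> 0 \<Longrightarrow> 4 * sin_half_sq x = 2 - x - inverse (x :: 'a)"
  by (simp add: sin_half_sq_def four_neq_0)

lemma sin_half_sq_eq_iff:
  fixes x y :: "'a :: field"
  assumes two: "(2 :: 'a) \<noteq> 0" and nz: "x \<noteq> 0" "y \<noteq> 0"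
  shows "sin_half_sq x = sin_half_sq y \<longleftrightarrow> x = y \<or> x * y = 1"
proof -
  have "sin_half_sq x = sin_half_sq y \<longleftrightarrow> 4 * sin_half_sq x = 4 * sin_half_sq y"
    using four_neq_0[OF two] by simp
  also have "\<dots> \<longleftrightarrow> 4 * sin_half_sq y - 4 * sin_half_sq x = 0"
    by auto
  also have "4 * sin_half_sq y - 4 * sin_half_sq x =
      (x - y) * (x * y - 1) * (inverse x * inverse y)"
    unfolding four_times_sin_half_sq[OF two] using nz by (simp add: field_simps)
  finally show ?thesis using nz by simp
qed

text \<open>
  Where 2 is invertible, this is \<open>(T\<^sub>8 (1 - 2 * y) - 1) / 2 ^ 15\<close>, where \<open>T\<^sub>8\<close> is the Chebyshev polynomial
  with \<open>T\<^sub>8 (cos \<phi>) = cos (8 * \<phi>)\<close>.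
\<close>
definition octic :: "'a :: field poly" where
  "octic = monom 1 8 - monom 4 7 + monom (13/2) 6 - monom (11/2) 5
           + monom (165/64) 4 - monom (21/32) 3 + monom (21/256) 2 - monom (1/256) 1"

lemma map_poly_to_ac_octic: "map_poly to_ac octic = octic"
  by (simp add: octic_def map_poly_to_ac_simps)

text \<open>
  With \<open>u = x + 1 / x\<close>, the map \<open>u \<mapsto> u\<^sup>2 - 2\<close> doubles the angle, so three iterations of it turn
  \<open>u\<close> into \<open>x ^ 8 + 1 / x ^ 8\<close>. Expanding the iterate at \<open>u = 2 - 4 * y\<close> gives the coefficients
  of the octic.
\<close>
lemma poly_octic_sin_half_sq:
  fixes x :: "'a :: field"
  assumes two: "(2 :: 'a) \<noteq> 0" and x: "x \<noteq> 0"
  shows "2 ^ 16 * poly octic (sin_half_sq x) = x ^ 8 + inverse x ^ 8 - 2"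
proof -
  define w where "w = inverse x"
  define y where "y = sin_half_sq x"
  define u where "u = x + w"
  have xw: "x * w = 1" using x by (simp add: w_def)
  have pow2: "(2 :: 'a) ^ n \<noteq> 0" for n using two by simp
  have nz: "(32 :: 'a) \<noteq> 0" "(64 :: 'a) \<noteq> 0" "(256 :: 'a) \<noteq> 0"
    using pow2[of 5] pow2[of 6] pow2[of 8] by simp_all
  have u: "u = 2 - 4 * y"
    by (simp add: u_def y_def w_def four_times_sin_half_sq[OF two])
  have octic_eq: "2 ^ 16 * poly octic y =
      65536 * y^8 - 262144 * y^7 + 425984 * y^6 - 360448 * y^5 + 168960 * y^4
      - 43008 * y^3 + 5376 * y^2 - 256 * y"
  proof -
    have c: "2 ^ 16 * 4 = (262144 :: 'a)"
      "2 ^ 16 * (13 / 2) = (425984 :: 'a)" "2 ^ 16 * (11 / 2) = (360448 :: 'a)"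
      "2 ^ 16 * (165 / 64) = (168960 :: 'a)" "2 ^ 16 * (21 / 32) = (43008 :: 'a)"
      "2 ^ 16 * (21 / 256) = (5376 :: 'a)" "2 ^ 16 * (1 / 256) = (256 :: 'a)"
      using two nz by (simp_all add: nonzero_eq_divide_eq)
    have p: "poly octic y = y ^ 8 - 4 * y ^ 7 + 13 / 2 * y ^ 6 - 11 / 2 * y ^ 5
        + 165 / 64 * y ^ 4 - 21 / 32 * y ^ 3 + 21 / 256 * y\<^sup>2 - 1 / 256 * y"
      by (simp add: octic_def poly_monom)
    have "N * (y ^ 8 - c7 * y ^ 7 + c6 * y ^ 6 - c5 * y ^ 5 + c4 * y ^ 4 - c3 * y ^ 3
          + c2 * y\<^sup>2 - c1 * y)
        = N * y ^ 8 - (N * c7) * y ^ 7 + (N * c6) * y ^ 6 - (N * c5) * y ^ 5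
          + (N * c4) * y ^ 4 - (N * c3) * y ^ 3 + (N * c2) * y\<^sup>2 - (N * c1) * y"
      for N c1 c2 c3 c4 c5 c6 c7 :: 'a
      by (simp add: algebra_simps)
    from this[of "2 ^ 16" 4 "13 / 2" "11 / 2" "165 / 64" "21 / 32" "21 / 256" "1 / 256"]
    show ?thesis unfolding c p by simp
  qed
  moreover have "\<dots> = ((u\<^sup>2 - 2)\<^sup>2 - 2)\<^sup>2 - 2 - 2"
  proof -
    have e1: "u\<^sup>2 - 2 = 16 * y\<^sup>2 - 16 * y + 2"
      unfolding u by (simp add: eval_nat_numeral algebra_simps)
    have e2: "(16 * y\<^sup>2 - 16 * y + 2)\<^sup>2 - 2
        = 256 * y ^ 4 - 512 * y ^ 3 + 320 * y\<^sup>2 - 64 * y + 2"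
      by (simp add: eval_nat_numeral algebra_simps)
    have e3: "(256 * y ^ 4 - 512 * y ^ 3 + 320 * y\<^sup>2 - 64 * y + 2)\<^sup>2 - 2 - 2
        = 65536 * y^8 - 262144 * y^7 + 425984 * y^6 - 360448 * y^5 + 168960 * y^4
          - 43008 * y^3 + 5376 * y^2 - 256 * y"
      by (simp add: eval_nat_numeral algebra_simps)
    show ?thesis unfolding e1 e2 e3 ..
  qed
  moreover have "\<dots> = x ^ 8 + w ^ 8 - 2"
  proof -
    (* The method is named in full because ring locales have one of the same short name. *)
    have d1: "u\<^sup>2 - 2 = x\<^sup>2 + w\<^sup>2"
      unfolding u_def using xw by Groebner_Basis.algebra
    have d2: "(x\<^sup>2 + w\<^sup>2)\<^sup>2 - 2 = x ^ 4 + w ^ 4"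
      using xw by Groebner_Basis.algebra
    have d3: "(x ^ 4 + w ^ 4)\<^sup>2 - 2 = x ^ 8 + w ^ 8"
      using xw by Groebner_Basis.algebra
    show ?thesis unfolding d1 d2 d3 ..
  qed
  ultimately have "2 ^ 16 * poly octic y = x ^ 8 + w ^ 8 - 2" by (simp only:)
  thus ?thesis unfolding y_def w_def .
qed

section \<open>Roots of unity\<close>

lemma inj_on_primitive_8th_root:
  fixes w :: "'a :: field"
  assumes w: "w ^ 4 = -1" and two: "(2 :: 'a) \<noteq> 0"
  shows "inj_on (\<lambda>k. w ^ k) {..<8}"
proof -
  have ne: "(1 :: 'a) \<noteq> -1" using two by (metis one_add_one add_eq_0_iff)
  have w0: "w \<noteq> 0" using w by auto
  have *: "w ^ d \<noteq> 1" if d: "0 < d" "d < 8" for d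
  proof
    assume wd: "w ^ d = 1"
    (* The order of w divides 8 but not 4; the cases below redo this for each d. *)
    have "(-1 :: 'a) ^ d = (w ^ d) ^ 4" by (metis w power_mult mult.commute)
    hence "even d" using ne wd by (auto simp: minus_one_power_iff split: if_splits)
    with d have "d = 2 \<or> d = 4 \<or> d = 6" by presburger
    then consider "d = 2" | "d = 4" | "d = 6" by blast
    thus False
    proof cases
      case 1
      hence "w ^ 4 = (w ^ d)\<^sup>2" by (simp flip: power_mult)
      thus False using wd w ne by simp
    next
      case 2
      thus False using wd w ne by simp
    next
      case 3
      hence "(w ^ d)\<^sup>2 = (w ^ 4) ^ 3" by (simp flip: power_mult)
      thus False using wd w ne by simp
    qed
  qed
  show ?thesis
  proof (rule linorder_inj_onI)
    fix j k :: nat assume jk: "j < k" "j \<in> {..<8}" "k \<in> {..<8}"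
    have "w ^ k = w ^ j * w ^ (k - j)" using jk by (simp flip: power_add)
    thus "w ^ j \<noteq> w ^ k" using *[of "k - j"] jk w0 by auto
  qed auto
qed

lemma odd_CARD_imp_two_neq_0:
  assumes "odd CARD('a :: finite_field)"
  shows "(2 :: 'a) \<noteq> 0"
proof
  assume "(2 :: 'a) = 0"
  hence "CHAR('a) dvd 2"
    using of_nat_eq_0_iff_char_dvd[of 2, where 'a = 'a] by simp
  moreover have "CHAR('a) \<noteq> 1" using CHAR_prime[where 'a = 'a] by (metis not_prime_1)
  ultimately have "CHAR('a) = 2" by (metis prime_nat_iff two_is_prime_nat)
  thus False using CHAR_dvd_CARD[where 'a = 'a] assms by simp
qed

lemma odd_CARD_if_cong_plus_minus_1_mod_16:
  assumes "[int CARD('a) = 1] (mod 16) \<or> [int CARD('a) = -1] (mod 16)"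
  shows "odd CARD('a)"
proof -
  have "odd (int CARD('a))" using assms by (auto simp: cong_def) presburger+
  thus ?thesis by simp
qed

text \<open>
  This is where the order of the field modulo 16 enters: the two residue classes are those for
  which Frobenius fixes, respectively inverts, all 16th roots of unity.
\<close>
lemma frob_16th_root_of_unity:
  fixes u :: "'a :: finite_field alg_closure"
  assumes u: "u ^ 16 = 1"
  shows "[int CARD('a) = 1] (mod 16) \<Longrightarrow> frob u = u"
    and "[int CARD('a) = -1] (mod 16) \<Longrightarrow> frob u = inverse u"
proof -
  have red: "u ^ n = u ^ (n mod 16)" for n
  proof -
    have "u ^ n = u ^ (16 * (n div 16) + n mod 16)" by simp
    also have "\<dots> = (u ^ 16) ^ (n div 16) * u ^ (n mod 16)"
      by (simp only: power_add power_mult)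
    finally show ?thesis by (simp add: u)
  qed
  show "frob u = u" if "[int CARD('a) = 1] (mod 16)"
  proof -
    have "int (CARD('a) mod 16) = 1" using that by (simp add: cong_def zmod_int)
    hence "CARD('a) mod 16 = 1" by linarith
    thus ?thesis by (simp add: frob_def red[of "CARD('a)"])
  qed
  show "frob u = inverse u" if "[int CARD('a) = -1] (mod 16)"
  proof -
    have "int (CARD('a) mod 16) = 15" using that by (simp add: cong_def zmod_int)
    hence "CARD('a) mod 16 = 15" by linarith
    hence "frob u = u ^ 15" by (simp add: frob_def red[of "CARD('a)"])
    moreover have "u ^ 15 * u = 1" using u by (simp add: flip: power_Suc2)
    ultimately show ?thesis by (metis inverse_unique mult.commute)
  qed
qed

text \<open>
  Take \<open>z\<close> with \<open>z ^ 8 = -1\<close>. Frobenius fixes or inverts \<open>z\<close>, so \<open>f = z + 1 / z\<close> is in the ground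
  field, and \<open>r = f\<^sup>2 - 2 = z\<^sup>2 + 1 / z\<^sup>2\<close> has square \<open>2 + z ^ 4 + 1 / z ^ 4 = 2\<close>. Since
  \<open>(2 + r) * (2 - r) = 2 = r\<^sup>2\<close>, the second factor is a square along with the first.
\<close>
lemma is_square_two_plus_minus_sqrt_two:
  assumes q: "[int CARD('a :: finite_field) = 1] (mod 16) \<or> [int CARD('a) = -1] (mod 16)"
  shows "\<exists>r :: 'a. r\<^sup>2 = 2 \<and> is_square (2 + r) \<and> is_square (2 - r)"
proof -
  have two: "(2 :: 'a) \<noteq> 0"
    using odd_CARD_imp_two_neq_0[OF odd_CARD_if_cong_plus_minus_1_mod_16[OF q]] .
  obtain z :: "'a alg_closure" where z8: "z ^ 8 = -1"
    using nth_root_exists[of 8 "-1"] by auto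
  have z0: "z \<noteq> 0" using z8 by auto
  define h where "h = inverse z"
  have zh: "z * h = 1" using z0 by (simp add: h_def)
  have "z ^ 16 = 1" using arg_cong[OF z8, of "\<lambda>u. u\<^sup>2"] by (simp flip: power_mult)
  hence "frob z = z \<or> frob z = h"
    using frob_16th_root_of_unity[of z] q by (auto simp: h_def)
  hence "frob (z + h) = z + h"
    by (auto simp: frob_add h_def frob_inverse add.commute)
  then obtain f where f: "z + h = to_ac f" using frob_fixed_imp_range by blast
  define r where "r = f\<^sup>2 - 2"
  have "to_ac (r\<^sup>2) = ((z + h)\<^sup>2 - 2)\<^sup>2" by (simp add: r_def f)
  also have "\<dots> = 2" using zh z8 by Groebner_Basis.algebra
  also have "2 = to_ac (2 :: 'a)" by simp
  finally have r: "r\<^sup>2 = 2" by (simp only: to_ac_eq_iff)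
  have f2: "f\<^sup>2 = 2 + r" by (simp add: r_def)
  have prod: "(2 + r) * (2 - r) = r\<^sup>2" using r by (simp add: algebra_simps power2_eq_square)
  have "2 + r \<noteq> 0" using prod r two by auto
  hence "2 - r = (r / f)\<^sup>2"
    using prod by (simp add: power_divide f2 field_simps)
  thus ?thesis using r f2 by (metis is_nth_power_nth_power)
qed

section \<open>The conjugates of a root\<close>

text \<open>
  Replacing \<open>x\<close> by its inverse does not change \<open>sin_half_sq x\<close>. This is why the two residue
  classes give the same conclusion: Frobenius sends \<open>x\<close> to \<open>x * w\<close> and fixes \<open>w\<close> in the
  first case, and sends \<open>x\<close> to \<open>1 / (x * w)\<close> and inverts \<open>w\<close> in the second. The last property
  excludes \<open>x * w ^ j = 1 / (x * w ^ k)\<close>, which is the only way in which distinct rotated points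
  could have the same value of \<open>sin_half_sq\<close>.
\<close>
lemma conjugates_of_root_of_g_poly:
  fixes y :: "'a :: finite_field alg_closure" and r s :: 'a
  assumes q: "[int CARD('a) = 1] (mod 16) \<or> [int CARD('a) = -1] (mod 16)"
    and r: "r\<^sup>2 = 2" and s: "1 - s\<^sup>2 = (2 + r) / 4"
    and y: "poly (map_poly to_ac (g_poly s)) y = 0"
  obtains x w where "x \<noteq> 0" "w ^ 4 = -1" "y = sin_half_sq x"
    and "\<And>k. frob (sin_half_sq (x * w ^ k)) = sin_half_sq (x * w ^ Suc k)"
    and "\<And>k. x\<^sup>2 * w ^ k \<noteq> 1"
proof -
  define n where "n = (CARD('a) + 1) div 2"
  have n: "Suc CARD('a) = 2 * n"
    using odd_CARD_if_cong_plus_minus_1_mod_16[OF q] by (auto simp: n_def elim!: oddE)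
  have two': "(2 :: 'a) \<noteq> 0"
    using odd_CARD_imp_two_neq_0[OF odd_CARD_if_cong_plus_minus_1_mod_16[OF q]] .
  hence two: "(2 :: 'a alg_closure) \<noteq> 0"
    using to_ac_eq_0_iff[of "2 :: 'a"] by simp
  have one: "(1 :: 'a alg_closure) \<noteq> -1"
    using two by (metis one_add_one add_eq_0_iff)

  obtain i :: "'a alg_closure" where i: "i\<^sup>2 = -1"
    using nth_root_exists[of 2 "-1"] by auto
  obtain a where a: "a\<^sup>2 = y" using nth_root_exists[of 2 y] by auto
  obtain b where b: "b\<^sup>2 = 1 - y" using nth_root_exists[of 2 "1 - y"] by auto
  (* With a = sin psi and b = cos psi, the elements t and t' are exp (i psi) and its inverse. *)
  define t where "t = b + i * a"
  define t' where "t' = b - i * a"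
  define A where "A = frob a"
  define B where "B = frob b"
  have tt': "t * t' = 1"
    unfolding t_def t'_def using i a b by Groebner_Basis.algebra
  have AB: "A\<^sup>2 + B\<^sup>2 = 1"
    unfolding A_def B_def frob_power [symmetric] frob_add [symmetric] a b by simp
  have "y ^ n + (1 - y) ^ n = to_ac s"
    using y by (simp add: g_poly_def Let_def map_poly_to_ac_simps one_pCons n_def diff_pCons
        poly_power)
  moreover have "a * A = y ^ n" "b * B = (1 - y) ^ n"
    unfolding A_def B_def frob_def power_Suc [symmetric] n by (simp_all add: power_mult a b)
  ultimately have S: "a * A + b * B = to_ac s" by simp

  (* e = exp (i theta), where theta is the difference of the angles of (a, b) and (A, B); its
     inverse is e', and twice its cosine is 2 s. *)
  define e where "e = (b + i * a) * (B - i * A)"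
  define e' where "e' = (b - i * a) * (B + i * A)"
  have ee': "e * e' = 1"
    unfolding e_def e'_def using i a b AB by Groebner_Basis.algebra
  have sum: "e + e' = 2 * to_ac s"
    unfolding e_def e'_def S [symmetric] using i by Groebner_Basis.algebra
  have "4 * s\<^sup>2 = 2 - r"
  proof -
    have "4 - 4 * s\<^sup>2 = 4 * (1 - s\<^sup>2)" by (simp add: algebra_simps)
    also have "\<dots> = 2 + r"
      unfolding s using four_neq_0[OF two'] by simp
    finally show ?thesis by Groebner_Basis.algebra
  qed
  hence "to_ac (4 * s\<^sup>2) = to_ac (2 - r)" by simp
  hence s2: "4 * (to_ac s)\<^sup>2 = 2 - to_ac r" by simp
  have r2: "(to_ac r)\<^sup>2 = 2" using arg_cong[OF r, of to_ac] by simp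
  (* Two angle doublings: 2 cos (2 theta) = - r, and 2 cos (4 theta) = r^2 - 2 = 0. *)
  have "e\<^sup>2 + e'\<^sup>2 = - to_ac r" using ee' sum s2 by Groebner_Basis.algebra
  hence "e ^ 4 + e' ^ 4 = 0" using ee' r2 by Groebner_Basis.algebra
  hence e'8: "e' ^ 8 = -1" using ee' by Groebner_Basis.algebra

  define x where "x = t\<^sup>2"
  define w where "w = e'\<^sup>2"
  have x0: "x \<noteq> 0" using tt' by (auto simp: x_def)
  have w4: "w ^ 4 = -1" using e'8 by (simp add: w_def flip: power_mult)
  have w0: "w \<noteq> 0" using w4 by auto
  have w16: "w ^ 16 = 1"
    using arg_cong[OF w4, of "\<lambda>z. z ^ 4"] by (simp flip: power_mult)
  have i16: "i ^ 16 = 1"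
    using arg_cong[OF i, of "\<lambda>z. z ^ 8"] by (simp flip: power_mult)
  have inv_x: "inverse x = t'\<^sup>2"
    using tt' by (intro inverse_unique) (simp add: x_def flip: power_mult_distrib)
  have yx: "y = sin_half_sq x"
  proof -
    have "4 * y = 2 - x - inverse x"
      unfolding inv_x unfolding x_def t_def t'_def using i a b by Groebner_Basis.algebra
    also have "\<dots> = 4 * sin_half_sq x"
      by (rule four_times_sin_half_sq [OF two, symmetric])
    finally show ?thesis using four_neq_0[OF two] by simp
  qed

  have fr_h: "frob (sin_half_sq z) = sin_half_sq (frob z)" for z :: "'a alg_closure"
    by (simp add: sin_half_sq_def frob_divide frob_diff frob_inverse)
  have cases: "frob w = w \<and> frob x = x * w \<and> (\<forall>u :: 'a alg_closure. u ^ 16 = 1 \<longrightarrow> frob u = u) \<or>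
      frob w = inverse w \<and> frob x = inverse (x * w) \<and>
        (\<forall>u :: 'a alg_closure. u ^ 16 = 1 \<longrightarrow> frob u = inverse u)"
    using q
  proof
    assume q: "[int CARD('a) = 1] (mod 16)"
    note root = frob_16th_root_of_unity(1)[OF _ q]
    have "frob t = B + i * A"
      by (simp add: t_def frob_add frob_mult A_def B_def root[OF i16])
    also have "\<dots> = t * e'" unfolding e'_def using tt' by (simp add: t_def t'_def)
    finally have "frob x = x * w" by (simp add: x_def w_def frob_power power_mult_distrib)
    thus ?thesis using root[OF w16] root by (intro disjI1) simp
  next
    assume q: "[int CARD('a) = -1] (mod 16)"
    note root = frob_16th_root_of_unity(2)[OF _ q]
    (* Here Frobenius moves i, so it carries b + i a to B - i A rather than to B + i A. *)
    have "inverse i = - i" using i by (intro inverse_unique) (simp add: power2_eq_square)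
    hence "frob t = B - i * A"
      by (simp add: t_def frob_add frob_mult A_def B_def root[OF i16])
    hence "t * e' * frob t = t * e' * (B - i * A)" by simp
    also have "\<dots> = (A\<^sup>2 + B\<^sup>2) * (t * t')"
      unfolding e'_def t_def t'_def using i by Groebner_Basis.algebra
    also have "\<dots> = 1" by (simp only: tt' AB mult_1_left)
    finally have "frob t = inverse (t * e')" by (rule inverse_unique [symmetric])
    hence "frob x = inverse (x * w)"
      by (simp add: x_def w_def frob_power power_mult_distrib power_inverse)
    thus ?thesis using root[OF w16] root by (intro disjI2) simp
  qed

  show ?thesis
  proof
    show "frob (sin_half_sq (x * w ^ k)) = sin_half_sq (x * w ^ Suc k)" for k
    proof -
      have "frob (x * w ^ k) = x * w ^ Suc k \<or> frob (x * w ^ k) = inverse (x * w ^ Suc k)"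
        using cases by (auto simp: frob_mult frob_power power_inverse mult_ac)
      thus ?thesis unfolding fr_h by (elim disjE) (simp_all only: sin_half_sq_inverse)
    qed
    show "x\<^sup>2 * w ^ k \<noteq> 1" for k
    proof
      assume "x\<^sup>2 * w ^ k = 1"
      (* Then x is a 16th root of unity, so Frobenius fixes or inverts it; but it also multiplies
         x by w, up to the same inversion. *)
      hence "(x\<^sup>2 * w ^ k) ^ 8 = 1" by simp
      also have "(x\<^sup>2 * w ^ k) ^ 8 = x ^ 16 * (w ^ 8) ^ k"
        by (simp add: power_mult_distrib mult.commute flip: power_mult)
      also have "w ^ 8 = (w ^ 4)\<^sup>2" by (simp flip: power_mult)
      finally have "x ^ 16 = 1" by (simp add: w4)
      hence "w = 1" using cases x0 w0 by auto
      thus False using w4 one by simp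
    qed
  qed (use x0 w4 yx in auto)
qed

section \<open>The irreducible factors\<close>

lemma degree_octic_diff_const: "degree (octic - monom m 0 :: 'a :: field poly) = 8"
  and lead_coeff_octic_diff_const: "lead_coeff (octic - monom m 0 :: 'a :: field poly) = 1"
proof -
  show deg: "degree (octic - monom m 0 :: 'a poly) = 8"
  proof (rule antisym)
    show "degree (octic - monom m 0 :: 'a poly) \<le> 8"
      unfolding octic_def
      by (intro degree_diff_le degree_add_le order.trans[OF degree_monom_le]) simp_all
    show "degree (octic - monom m 0 :: 'a poly) \<ge> 8"
      by (rule le_degree) (simp add: octic_def)
  qed
  show "lead_coeff (octic - monom m 0 :: 'a :: field poly) = 1"
    unfolding deg by (simp add: octic_def)
qed

text \<open>
  A root of \<open>I\<close> has at least eight distinct conjugates, so \<open>I\<close> has degree at least 8. The value of the octic at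
  that root is the same at all these conjugates, hence it is a constant \<open>m\<close> of the ground field and \<open>I\<close>
  divides \<open>octic - m\<close>; comparing degrees and leading coefficients leaves only equality.
\<close>
lemma irreducible_factor_eq_octic_diff_const:
  fixes I :: "'a :: finite_field poly" and r s :: 'a
  assumes q: "[int CARD('a) = 1] (mod 16) \<or> [int CARD('a) = -1] (mod 16)"
    and r: "r\<^sup>2 = 2" and s: "1 - s\<^sup>2 = (2 + r) / 4"
    and I: "lead_coeff I = 1" "irreducible I" "I dvd g_poly s"
  shows "\<exists>m. I = octic - monom m 0"
proof -
  have two: "(2 :: 'a alg_closure) \<noteq> 0"
    using odd_CARD_imp_two_neq_0[OF odd_CARD_if_cong_plus_minus_1_mod_16[OF q]]
      to_ac_eq_0_iff[of "2 :: 'a"] by simp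
  have I0: "I \<noteq> 0" using I(2) by auto
  hence "degree I > 0" using I(2) is_unit_iff_degree by (metis irreducible_not_unit gr0I)
  hence "degree (map_poly to_ac I) > 0" by simp
  then obtain y where y: "poly (map_poly to_ac I) y = 0"
    using alg_closed_imp_poly_has_root by blast
  have "poly (map_poly to_ac (g_poly s)) y = 0"
    using I(3) y by (auto simp: map_poly_to_ac_mult elim!: dvdE)
  from conjugates_of_root_of_g_poly[OF q r s this] obtain x w
    where x0: "x \<noteq> 0" and w4: "w ^ 4 = -1" and yx: "y = sin_half_sq x"
      and step: "\<And>k. frob (sin_half_sq (x * w ^ k)) = sin_half_sq (x * w ^ Suc k)"
      and ne: "\<And>k. x\<^sup>2 * w ^ k \<noteq> 1" by metis
  have w0: "w \<noteq> 0" using w4 by auto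

  have root: "poly (map_poly to_ac I) (sin_half_sq (x * w ^ k)) = 0" for k
  proof (induction k)
    case 0
    thus ?case using y yx by simp
  next
    case (Suc k)
    thus ?case by (metis step frob_poly frob_0)
  qed
  have inj: "inj_on (\<lambda>k. sin_half_sq (x * w ^ k)) {..<8}"
  proof (rule inj_onI)
    fix j k :: nat assume jk: "j \<in> {..<8}" "k \<in> {..<8}"
      and "sin_half_sq (x * w ^ j) = sin_half_sq (x * w ^ k)"
    hence "x * w ^ j = x * w ^ k \<or> (x * w ^ j) * (x * w ^ k) = 1"
      using x0 w0 by (simp add: sin_half_sq_eq_iff[OF two])
    moreover have "(x * w ^ j) * (x * w ^ k) = x\<^sup>2 * w ^ (j + k)"
      by (simp add: power_add power2_eq_square mult_ac)
    ultimately have "w ^ j = w ^ k" using ne x0 by auto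
    thus "j = k" using inj_on_primitive_8th_root[OF w4 two] jk by (auto dest: inj_onD)
  qed
  have "8 \<le> card {z. poly (map_poly to_ac I) z = 0}"
    using card_mono[of "{z. poly (map_poly to_ac I) z = 0}"
        "(\<lambda>k. sin_half_sq (x * w ^ k)) ` {..<8}"] root I0
    by (auto simp: card_image[OF inj] poly_roots_finite)
  also have "\<dots> \<le> degree I"
    using card_poly_roots_bound[of "map_poly to_ac I"] I0 by simp
  finally have degI: "8 \<le> degree I" .

  define v where "v = poly octic y"
  have "2 ^ 16 * frob v = 2 ^ 16 * v"
  proof -
    have "frob v = poly octic (sin_half_sq (x * w))"
      using frob_poly[of octic y] step[of 0] by (simp add: v_def yx map_poly_to_ac_octic)
    hence "2 ^ 16 * frob v = (x * w) ^ 8 + inverse (x * w) ^ 8 - 2"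
      using poly_octic_sin_half_sq[OF two, of "x * w"] x0 w0 by simp
    also have "w ^ 8 = (w ^ 4)\<^sup>2" by (simp flip: power_mult)
    hence "w ^ 8 = 1" by (simp add: w4)
    hence "(x * w) ^ 8 + inverse (x * w) ^ 8 - 2 = x ^ 8 + inverse x ^ 8 - 2"
      by (simp add: power_mult_distrib power_inverse)
    also have "\<dots> = 2 ^ 16 * v"
      using poly_octic_sin_half_sq[OF two x0] by (simp add: v_def yx)
    finally show ?thesis .
  qed
  hence "frob v = v" using two by (metis mult_left_cancel power_not_zero)
  then obtain m where m: "v = to_ac m" using frob_fixed_imp_range by blast
  have "poly (map_poly to_ac (octic - monom m 0)) y = 0"
    using m by (simp add: map_poly_to_ac_simps map_poly_to_ac_octic v_def poly_monom)
  with I(2) y have "I dvd octic - monom m 0" by (rule irreducible_dvd_if_common_root)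
  then obtain u where u: "octic - monom m 0 = I * u" by (elim dvdE)
  have "u \<noteq> 0" using u degree_octic_diff_const[of m] by auto
  hence "degree I + degree u = 8"
    using u degree_octic_diff_const[of m] I0 by (simp add: degree_mult_eq)
  hence "degree u = 0" using degI by simp
  moreover have "lead_coeff u = 1"
    using lead_coeff_octic_diff_const[of m] I(1) by (simp add: u lead_coeff_mult)
  ultimately have "u = 1" by (auto elim: degree_eq_zeroE simp: one_pCons)
  thus ?thesis using u by auto
qed

theorem corollary4p10:
  assumes q: "[int (CARD('a :: finite_field)) = 1] (mod 16) \<or>
              [int (CARD('a)) = -1] (mod 16)"
  shows "is_square (2 :: 'a) \<and>
         (\<forall>(r :: 'a) (c :: 'a). r\<^sup>2 = 2 \<longrightarrow> c = (2 + r) / 4 \<longrightarrow>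
            c \<in> C_set \<and>
            (\<forall>s :: 'a. 1 - s\<^sup>2 = c \<longrightarrow>
               (\<forall>I :: 'a poly. lead_coeff I = 1 \<longrightarrow> irreducible I \<longrightarrow> I dvd g_poly s \<longrightarrow>
                  (\<exists>m :: 'a. I =
                     monom 1 8 - monom 4 7 + monom (13/2) 6 - monom (11/2) 5
                     + monom (165/64) 4 - monom (21/32) 3 + monom (21/256) 2
                     - monom (1/256) 1 - monom m 0))))"
proof (intro conjI allI impI)
  have two: "(2 :: 'a) \<noteq> 0"
    using odd_CARD_imp_two_neq_0[OF odd_CARD_if_cong_plus_minus_1_mod_16[OF q]] .
  obtain r0 :: 'a where r0: "r0\<^sup>2 = 2" and sq: "is_square (2 + r0)" "is_square (2 - r0)"
    using is_square_two_plus_minus_sqrt_two[OF q] by blast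
  show "is_square (2 :: 'a)" using is_nth_power_nth_power[of 2 r0] by (simp add: r0)
  fix r c :: 'a
  assume r: "r\<^sup>2 = 2" and c: "c = (2 + r) / 4"
  (* Passing to the other square root of 2 exchanges 2 + r and 2 - r. *)
  have "r = r0 \<or> r = - r0" using r r0 by (simp flip: power2_eq_iff)
  hence sq': "is_square (2 + r)" "is_square (2 - r)" using sq by auto
  have char1: "quad_char (z / 4) = 1" if z: "is_square z" "z \<noteq> 0" for z :: 'a
  proof -
    obtain f where "z = f\<^sup>2" using z(1) by (elim is_nth_powerE)
    hence "z / 4 = (f / 2)\<^sup>2" by (simp add: power_divide)
    thus ?thesis using z(2) four_neq_0[OF two] by (auto simp: quad_char_def)
  qed
  have "(2 + r) * (2 - r) = 2"
    using r by (simp add: algebra_simps power2_eq_square)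
  hence nz: "2 + r \<noteq> 0" "2 - r \<noteq> 0" using two by auto
  have c': "1 - c = (2 - r) / 4"
    using four_neq_0[OF two] by (simp add: c field_simps)
  have "quad_char c = 1" "quad_char (1 - c) = 1"
    unfolding c' unfolding c using char1 sq' nz by blast+
  thus "c \<in> C_set" by (simp add: C_set_def)
  fix s :: 'a and I :: "'a poly"
  assume "1 - s\<^sup>2 = c" "lead_coeff I = 1" "irreducible I" "I dvd g_poly s"
  thus "\<exists>m :: 'a. I =
                     monom 1 8 - monom 4 7 + monom (13/2) 6 - monom (11/2) 5
                     + monom (165/64) 4 - monom (21/32) 3 + monom (21/256) 2
                     - monom (1/256) 1 - monom m 0"
    using irreducible_factor_eq_octic_diff_const[OF q r] by (simp add: c octic_def)
qed

end
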